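(* Let $O_e$ and $O_p$ be disjoint finite sets of Boolean variables (the outputs of the environment and of component $p$), and let $\varphi_p$ be an LTL formula over $O_p \cup O_e$. Then there exists a nondeterministic finite automaton over the alphabet $2^{O_e}\times 2^{O_e}$, whose number of states is doubly exponential in the length of $\varphi_p$, that recognizes the prefix distinguishability relation $\rho_{\varphi_p}$, i.e., it accepts a finite word $(x_0,x_0')(x_1,x_1')\cdots(x_{m-1},x_{m-1}')$ if and only if $(x_0x_1\cdots x_{m-1},\,x_0'x_1'\cdots x_{m-1}')\in\rho_{\varphi_p}$.
   Context: A valuation of a set $V$ of Boolean variables is a subset of $V$ (the variables set to true). For traces (finite or infinite sequences of valuations) $x_0x_1\ldots$ over $V$ and $y_0y_1\ldots$ over a disjoint set $V'$ of the same length, $x_0x_1\ldots\sqcup y_0y_1\ldots=(x_0\cup y_0)(x_1\cup y_1)\ldots$. For a trace $\pi$, $\pi[0\ldots n]$ denotes its prefix up to index $n$. A finite trace $\sigma$ is a bad prefix of an LTL formula $\varphi$ if no infinite extension $\sigma\cdot\sigma'$ satisfies $\varphi$; for a finite trace $\sigma$ of length $n$, $\sigma\vDash_n\varphi$ means $\sigma$ is not a bad prefix of $\varphi$. The prefix distinguishability relation $\rho_{\varphi_p}$ is the set of pairs $(\pi,\pi')\in(2^{O_e})^m\times(2^{O_e})^m$, for some $m\in\mathbb N$, such that (i) for every $\pi_p\in(2^{O_p})^m$, $\pi\sqcup\pi_p\nvDash_m\varphi_p$ or $\pi'\sqcup\pi_p\nvDash_m\varphi_p$; and (ii) for every $n<m$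 there exists $\pi_p'\in(2^{O_p})^n$ with $\pi[0\ldots n]\sqcup\pi_p'\vDash_n\varphi_p$ and $\pi'[0\ldots n]\sqcup\pi_p'\vDash_n\varphi_p$. *)

theory Defs
  imports Main "HOL-Library.Omega_Words_Fun"
begin

text \<open>
  LTL over the connectives true, negation, conjunction, next and (strong) until. The other usual
  operators are derived from these.
\<close>

datatype (atoms: 'a) ltl =
    LTrue
  | LAtom 'a
  | LNot "'a ltl"
  | LAnd "'a ltl" "'a ltl"
  | LNext "'a ltl"
  | LUntil "'a ltl" "'a ltl"

text \<open>The length counts the occurrences of connectives and atoms. The automatically generated
  \<open>size\<close> function is not used, as it gives the nullary constructors size 0.\<close>

primrec ltl_length :: "'a ltl \<Rightarrow> nat" where
  "ltl_length LTrue = 1"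
| "ltl_length (LAtom a) = 1"
| "ltl_length (LNot \<phi>) = 1 + ltl_length \<phi>"
| "ltl_length (LAnd \<phi> \<psi>) = 1 + ltl_length \<phi> + ltl_length \<psi>"
| "ltl_length (LNext \<phi>) = 1 + ltl_length \<phi>"
| "ltl_length (LUntil \<phi> \<psi>) = 1 + ltl_length \<phi> + ltl_length \<psi>"

primrec sat :: "'a set word \<Rightarrow> 'a ltl \<Rightarrow> bool" (infix "\<Turnstile>" 50) where
  "w \<Turnstile> LTrue \<longleftrightarrow> True"
| "w \<Turnstile> LAtom a \<longleftrightarrow> a \<in> w 0"
| "w \<Turnstile> LNot \<phi> \<longleftrightarrow> \<not> w \<Turnstile> \<phi>"
| "w \<Turnstile> LAnd \<phi> \<psi> \<longleftrightarrow> w \<Turnstile> \<phi> \<and> w \<Turnstile> \<psi>"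
| "w \<Turnstile> LNext \<phi> \<longleftrightarrow> suffix 1 w \<Turnstile> \<phi>"
| "w \<Turnstile> LUntil \<phi> \<psi> \<longleftrightarrow> (\<exists>k. suffix k w \<Turnstile> \<psi> \<and> (\<forall>j<k. suffix j w \<Turnstile> \<phi>))"

definition finite_traces :: "'a set \<Rightarrow> nat \<Rightarrow> 'a set list set" where
  "finite_traces V m = {\<sigma>. set \<sigma> \<subseteq> Pow V \<and> length \<sigma> = m}"

definition infinite_traces :: "'a set \<Rightarrow> 'a set word set" where
  "infinite_traces V = {w. range w \<subseteq> Pow V}"

text \<open>Only applied to traces of the same length; \<^const>\<open>map2\<close> truncates to the shorter one.\<close>

definition trace_join :: "'a set list \<Rightarrow> 'a set list \<Rightarrow> 'a set list" (infixl "\<squnion>\<^sub>t" 65) where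
  "\<sigma> \<squnion>\<^sub>t \<tau> = map2 (\<union>) \<sigma> \<tau>"

definition bad_prefix :: "'a set \<Rightarrow> 'a ltl \<Rightarrow> 'a set list \<Rightarrow> bool" where
  "bad_prefix V \<phi> \<sigma> \<longleftrightarrow> \<not> (\<exists>\<sigma>' \<in> infinite_traces V. \<sigma> \<frown> \<sigma>' \<Turnstile> \<phi>)"

text \<open>Satisfaction on finite traces. The index in $\sigma \vDash_n \varphi$ is always the length of
  $\sigma$ and is therefore omitted.\<close>

definition fin_sat :: "'a set \<Rightarrow> 'a set list \<Rightarrow> 'a ltl \<Rightarrow> bool" where
  "fin_sat V \<sigma> \<phi> \<longleftrightarrow> \<not> bad_prefix V \<phi> \<sigma>"

text \<open>
  In the second condition, the prefix that is joined with a trace of length \<open>n\<close> has length \<open>n\<close>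
  itself, that is, it consists of the valuations at positions \<open>0, \<dots>, n - 1\<close>.
\<close>

definition prefix_dist :: "'a set \<Rightarrow> 'a set \<Rightarrow> 'a ltl \<Rightarrow> ('a set list \<times> 'a set list) set" where
  "prefix_dist Oe Op \<phi> = {(\<pi>, \<pi>'). \<exists>m.
     \<pi> \<in> finite_traces Oe m \<and> \<pi>' \<in> finite_traces Oe m \<and>
     (\<forall>\<pi>p \<in> finite_traces Op m.
        \<not> fin_sat (Oe \<union> Op) (\<pi> \<squnion>\<^sub>t \<pi>p) \<phi> \<or> \<not> fin_sat (Oe \<union> Op) (\<pi>' \<squnion>\<^sub>t \<pi>p) \<phi>) \<and>
     (\<forall>n<m. \<exists>\<pi>p \<in> finite_traces Op n.
        fin_sat (Oe \<union> Op) (take n \<pi> \<squnion>\<^sub>t \<pi>p) \<phi> \<and> fin_sat (Oe \<union> Op) (take n \<pi>' \<squnion>\<^sub>t \<pi>p) \<phi>)}"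

record ('q, 's) nfa =
  states :: "'q set"
  initial :: "'q set"
  trans :: "('q \<times> 's \<times> 'q) set"
  accepting :: "'q set"

definition nfa_over :: "'s set \<Rightarrow> ('q, 's) nfa \<Rightarrow> bool" where
  "nfa_over \<Sigma> A \<longleftrightarrow> finite \<Sigma> \<and> finite (states A) \<and> initial A \<subseteq> states A \<and>
     accepting A \<subseteq> states A \<and> trans A \<subseteq> states A \<times> \<Sigma> \<times> states A"

definition nfa_accepts :: "('q, 's) nfa \<Rightarrow> 's list \<Rightarrow> bool" where
  "nfa_accepts A w \<longleftrightarrow> (\<exists>r. length r = length w + 1 \<and> r ! 0 \<in> initial A \<and>
     (\<forall>i<length w. (r ! i, w ! i, r ! (i + 1)) \<in> trans A) \<and> r ! length w \<in> accepting A)"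

end

theory Submission
  imports Defs
begin

text \<open>
  The truth values of the subformulas of \<open>\<phi>\<close> on an infinite word \<open>u\<close> form its type. The type of
  \<open>\<sigma> \<frown> u\<close> depends only on \<open>\<sigma>\<close> and on the type of \<open>u\<close>, because an until formula on
  \<open>a ## u\<close> unfolds to its operands on \<open>a ## u\<close> and the formula itself on \<open>u\<close>. Hence it
  suffices to remember, after reading \<open>(\<pi>, \<pi>')\<close>, the set of pairs of types of infinite words
  \<open>u\<close>, \<open>u'\<close> for which some common \<open>\<pi>\<^sub>p\<close> lets both \<open>(\<pi> \<squnion> \<pi>\<^sub>p) \<frown> u\<close> and
  \<open>(\<pi>' \<squnion> \<pi>\<^sub>p) \<frown> u'\<close> satisfy \<open>\<phi>\<close>. There are at most \<open>2 ^ n\<close> types, so at most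
  \<open>2 ^ (2 ^ (2 * n))\<close> such sets, and \<open>(\<pi>, \<pi>')\<close> is in the relation iff the empty set is
  reached at its end and not earlier. Each pair of types
  forgets the \<open>\<pi>\<^sub>p\<close> that produced it: remembering which pairs share a \<open>\<pi>\<^sub>p\<close>, as in a
  subset construction on top of deterministic automata for bad prefixes, would cost a third
  exponential.
\<close>

section \<open>Types of infinite words\<close>

primrec subformulas :: "'a ltl \<Rightarrow> 'a ltl set" where
  "subformulas LTrue = {LTrue}"
| "subformulas (LAtom a) = {LAtom a}"
| "subformulas (LNot \<phi>) = insert (LNot \<phi>) (subformulas \<phi>)"
| "subformulas (LAnd \<phi> \<psi>) = insert (LAnd \<phi> \<psi>) (subformulas \<phi> \<union> subformulas \<psi>)"
| "subformulas (LNext \<phi>) = insert (LNext \<phi>) (subformulas \<phi>)"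
| "subformulas (LUntil \<phi> \<psi>) = insert (LUntil \<phi> \<psi>) (subformulas \<phi> \<union> subformulas \<psi>)"

lemma self_in_subformulas: "\<phi> \<in> subformulas \<phi>"
  by (cases \<phi>) auto

lemma finite_subformulas: "finite (subformulas \<phi>)"
  by (induction \<phi>) auto

lemma card_subformulas_le: "card (subformulas \<phi>) \<le> ltl_length \<phi>"
proof (induction \<phi>)
  case (LAnd \<phi> \<psi>)
  then show ?case
    using card_Un_le[of "subformulas \<phi>" "subformulas \<psi>"]
    by (simp add: card_insert_if finite_subformulas)
next
  case (LUntil \<phi> \<psi>)
  then show ?case
    using card_Un_le[of "subformulas \<phi>" "subformulas \<psi>"]
    by (simp add: card_insert_if finite_subformulas)
qed (simp_all add: card_insert_if finite_subformulas)

lemma suffix_Suc_build [simp]: "suffix (Suc k) (a ## u) = suffix k u"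
  by (rule ext) simp

text \<open>The expansion law: a witness position is either 0 or a successor, and in the second case
  it shifts to a position of the tail.\<close>

lemma sat_until_build:
  "a ## u \<Turnstile> LUntil \<phi> \<psi> \<longleftrightarrow> a ## u \<Turnstile> \<psi> \<or> (a ## u \<Turnstile> \<phi> \<and> u \<Turnstile> LUntil \<phi> \<psi>)"
proof
  assume "a ## u \<Turnstile> LUntil \<phi> \<psi>"
  then obtain k where k: "suffix k (a ## u) \<Turnstile> \<psi>" "\<forall>j<k. suffix j (a ## u) \<Turnstile> \<phi>"
    by auto
  show "a ## u \<Turnstile> \<psi> \<or> (a ## u \<Turnstile> \<phi> \<and> u \<Turnstile> LUntil \<phi> \<psi>)"
  proof (cases k)
    case 0
    then show ?thesis using k(1) by simp
  next
    case (Suc k')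
    have "suffix k' u \<Turnstile> \<psi>" using k(1) Suc by simp
    moreover have "suffix j u \<Turnstile> \<phi>" if "j < k'" for j
      using k(2)[rule_format, of "Suc j"] Suc that by simp
    moreover have "a ## u \<Turnstile> \<phi>" using k(2)[rule_format, of 0] Suc by simp
    ultimately show ?thesis by auto
  qed
next
  assume "a ## u \<Turnstile> \<psi> \<or> (a ## u \<Turnstile> \<phi> \<and> u \<Turnstile> LUntil \<phi> \<psi>)"
  then show "a ## u \<Turnstile> LUntil \<phi> \<psi>"
  proof
    assume "a ## u \<Turnstile> \<psi>"
    then have "suffix 0 (a ## u) \<Turnstile> \<psi>" by simp
    then show ?thesis unfolding sat.simps by blast
  next
    assume r: "a ## u \<Turnstile> \<phi> \<and> u \<Turnstile> LUntil \<phi> \<psi>"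
    then obtain k where k: "suffix k u \<Turnstile> \<psi>" "\<forall>j<k. suffix j u \<Turnstile> \<phi>"
      by auto
    have "suffix (Suc k) (a ## u) \<Turnstile> \<psi>" using k(1) by simp
    moreover have "suffix j (a ## u) \<Turnstile> \<phi>" if "j < Suc k" for j
      using k(2) r that by (cases j) auto
    ultimately show ?thesis unfolding sat.simps by blast
  qed
qed

definition ltl_type :: "'a ltl \<Rightarrow> 'a set word \<Rightarrow> 'a ltl set" where
  "ltl_type \<phi> u = {\<psi> \<in> subformulas \<phi>. u \<Turnstile> \<psi>}"

lemma ltl_type_eq_iff:
  "ltl_type \<phi> u = ltl_type \<phi> v \<longleftrightarrow> (\<forall>\<psi> \<in> subformulas \<phi>. u \<Turnstile> \<psi> \<longleftrightarrow> v \<Turnstile> \<psi>)"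
  unfolding ltl_type_def by auto

text \<open>Induction on the formula: the outermost connective on \<open>a ## u\<close> is settled
  by \<open>a\<close>, by the operands on \<open>a ## u\<close>, and by subformulas on
  \<open>u\<close>, on which \<open>u\<close> and \<open>v\<close> agree.\<close>

lemma ltl_type_build_cong:
  assumes "ltl_type \<phi> u = ltl_type \<phi> v"
  shows "ltl_type \<phi> (a ## u) = ltl_type \<phi> (a ## v)"
proof -
  have "\<forall>\<psi> \<in> subformulas \<phi>. a ## u \<Turnstile> \<psi> \<longleftrightarrow> a ## v \<Turnstile> \<psi>"
    if "\<forall>\<psi> \<in> subformulas \<phi>. u \<Turnstile> \<psi> \<longleftrightarrow> v \<Turnstile> \<psi>"
    using that
  proof (induction \<phi>)
    case (LNext \<phi>)
    then show ?case using self_in_subformulas[of \<phi>] by simp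
  next
    case (LUntil \<phi> \<psi>)
    \<comment> \<open>Until must stay folded here, so that the assumption about the until formula
      itself on \<open>u\<close> and \<open>v\<close> applies.\<close>
    have "a ## u \<Turnstile> LUntil \<phi> \<psi> \<longleftrightarrow> a ## v \<Turnstile> LUntil \<phi> \<psi>"
      unfolding sat_until_build using LUntil self_in_subformulas[of \<phi>] self_in_subformulas[of \<psi>]
      by (simp del: sat.simps)
    then show ?case using LUntil by (simp add: ball_Un del: sat.simps)
  qed (auto simp: self_in_subformulas)
  then show ?thesis using assms by (simp add: ltl_type_eq_iff)
qed

text \<open>The letters of \<sigma> are put in front one at a time, each preserving equality of
  types.\<close>

lemma sat_conc_type_cong:
  assumes "ltl_type \<phi> u = ltl_type \<phi> v"
  shows "\<sigma> \<frown> u \<Turnstile> \<phi> \<longleftrightarrow> \<sigma> \<frown> v \<Turnstile> \<phi>"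
proof -
  have "ltl_type \<phi> (\<sigma> \<frown> u) = ltl_type \<phi> (\<sigma> \<frown> v)"
  proof (induction \<sigma>)
    case (Cons a \<sigma>)
    then show ?case unfolding build_cons by (rule ltl_type_build_cong)
  qed (simp add: assms)
  then show ?thesis using self_in_subformulas[of \<phi>] by (simp add: ltl_type_eq_iff)
qed

lemma build_infinite_traces:
  "a ## u \<in> infinite_traces V \<longleftrightarrow> a \<subseteq> V \<and> u \<in> infinite_traces V"
  unfolding infinite_traces_def by simp

lemma fin_sat_iff: "fin_sat V \<sigma> \<phi> \<longleftrightarrow> (\<exists>u \<in> infinite_traces V. \<sigma> \<frown> u \<Turnstile> \<phi>)"
  unfolding fin_sat_def bad_prefix_def by simp

section \<open>Automata from right congruences\<close>

text \<open>Only states in \<open>E\<close> have outgoing transitions, so a complete run certifies the condition on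
  the proper prefixes.\<close>

lemma nfa_of_right_congruence:
  fixes S :: "'s list \<Rightarrow> 'q" and E F :: "'q set"
  assumes "finite \<Sigma>" and fin: "finite (S ` lists \<Sigma>)"
    and cong: "\<And>u v a. \<lbrakk>u \<in> lists \<Sigma>; v \<in> lists \<Sigma>; a \<in> \<Sigma>; S u = S v\<rbrakk> \<Longrightarrow> S (u @ [a]) = S (v @ [a])"
  shows "\<exists>A :: (nat, 's) nfa. nfa_over \<Sigma> A \<and> card (states A) = card (S ` lists \<Sigma>) \<and>
    (\<forall>w \<in> lists \<Sigma>. nfa_accepts A w \<longleftrightarrow> S w \<in> F \<and> (\<forall>n < length w. S (take n w) \<in> E))"
proof -
  \<comment> \<open>Numbering the finitely many values of \<open>S\<close> yields automata over the
    fixed state type \<open>nat\<close>.\<close>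
  obtain f :: "'q \<Rightarrow> nat" where f: "inj_on f (S ` lists \<Sigma>)"
    using finite_imp_inj_to_nat_seg[OF fin] by auto
  have f_eq: "f (S u) = f (S v) \<longleftrightarrow> S u = S v" if "u \<in> lists \<Sigma>" "v \<in> lists \<Sigma>" for u v
    using inj_on_eq_iff[OF f] that by blast
  define A where "A = \<lparr>states = f ` S ` lists \<Sigma>, initial = {f (S [])},
    trans = {(f (S u), a, f (S (u @ [a]))) | u a. u \<in> lists \<Sigma> \<and> a \<in> \<Sigma> \<and> S u \<in> E},
    accepting = f ` (F \<inter> S ` lists \<Sigma>)\<rparr>"
  have "[] \<in> lists \<Sigma>" and "\<And>u a. u \<in> lists \<Sigma> \<Longrightarrow> a \<in> \<Sigma> \<Longrightarrow> u @ [a] \<in> lists \<Sigma>"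
    by simp_all
  then have "nfa_over \<Sigma> A"
    using assms(1) fin unfolding nfa_over_def A_def nfa.simps by blast
  moreover have "card (states A) = card (S ` lists \<Sigma>)"
    using card_image[OF f] by (simp add: A_def)
  moreover have "nfa_accepts A w \<longleftrightarrow> S w \<in> F \<and> (\<forall>n < length w. S (take n w) \<in> E)"
    if w: "w \<in> lists \<Sigma>" for w
  proof
    assume "nfa_accepts A w"
    then obtain r where r: "r ! 0 \<in> initial A" "r ! length w \<in> accepting A"
      and tr: "\<And>i. i < length w \<Longrightarrow> (r ! i, w ! i, r ! (i + 1)) \<in> trans A"
      unfolding nfa_accepts_def by blast
    have pre: "take n w \<in> lists \<Sigma>" for n
      using w set_take_subset[of n w] by (auto simp: in_lists_conv_set)
    have step: "r ! Suc n = f (S (take (Suc n) w)) \<and> S (take n w) \<in> E"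
      if n: "n < length w" "r ! n = f (S (take n w))" for n
    proof -
      \<comment> \<open>The transition may stem from a representative \<open>u\<close> other than
        \<open>take n w\<close>. Injectivity of \<open>f\<close> gives both the same value of
        \<open>S\<close>, and \<open>cong\<close> the same successor.\<close>
      obtain u where u: "u \<in> lists \<Sigma>" "w ! n \<in> \<Sigma>" "S u \<in> E" "r ! n = f (S u)"
        "r ! Suc n = f (S (u @ [w ! n]))"
        using tr[OF n(1)] by (auto simp: A_def)
      have eq: "S u = S (take n w)"
        using f_eq[OF u(1) pre] u(4) n(2) by metis
      then have "S (u @ [w ! n]) = S (take n w @ [w ! n])"
        using cong[OF u(1) pre u(2)] by blast
      then show ?thesis
        using u eq n(1) by (simp add: take_Suc_conv_app_nth)
    qed
    have run: "r ! n = f (S (take n w))" if "n \<le> length w" for n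
      using that
    proof (induction n)
      case 0
      then show ?case using r(1) by (simp add: A_def)
    next
      case (Suc n)
      then show ?case using step[of n] by simp
    qed
    have "f (S w) \<in> f ` (F \<inter> S ` lists \<Sigma>)"
      using r(2) run[of "length w"] by (simp add: A_def)
    then obtain v where "f (S w) = f (S v)" "S v \<in> F" "v \<in> lists \<Sigma>" by auto
    then have "S w \<in> F" using f_eq[OF w] by metis
    then show "S w \<in> F \<and> (\<forall>n < length w. S (take n w) \<in> E)"
      using step run by (meson less_imp_le)
  next
    assume acc: "S w \<in> F \<and> (\<forall>n < length w. S (take n w) \<in> E)"
    \<comment> \<open>The run passes through the values of \<open>S\<close> on all prefixes, from
      the empty one to \<open>w\<close> itself.\<close>
    define r where "r = map (\<lambda>n. f (S (take n w))) [0..<length w + 1]"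
    have nth: "r ! n = f (S (take n w))" if "n \<le> length w" for n
      using that nth_map[of n "[0..<length w + 1]" "\<lambda>n. f (S (take n w))"]
      unfolding r_def by (simp del: upt_Suc)
    have "(r ! i, w ! i, r ! (i + 1)) \<in> trans A" if "i < length w" for i
    proof -
      have "take i w \<in> lists \<Sigma>" "w ! i \<in> \<Sigma>"
        using w that set_take_subset[of i w] by (auto simp: in_lists_conv_set)
      then show ?thesis
        using that acc nth[of i] nth[of "Suc i"] unfolding A_def
        by (auto simp: take_Suc_conv_app_nth)
    qed
    moreover have "length r = length w + 1" by (simp add: r_def)
    ultimately show "nfa_accepts A w"
      unfolding nfa_accepts_def using acc w nth[of 0] nth[of "length w"]
      by (intro exI[of _ r]) (auto simp: A_def)
  qed
  ultimately show ?thesis by blast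
qed

section \<open>Joint types as states\<close>

text \<open>Only the trace over \<open>Op\<close> is shared. The continuations \<open>u\<close> and
  \<open>u'\<close> are independent, even on \<open>Op\<close>, because each \<open>fin_sat\<close>
  has its own existential extension.\<close>

definition joint_types ::
  "'a set \<Rightarrow> 'a set \<Rightarrow> 'a ltl \<Rightarrow> ('a set \<times> 'a set) list \<Rightarrow> ('a ltl set \<times> 'a ltl set) set" where
  "joint_types Oe Op \<phi> w = {(ltl_type \<phi> u, ltl_type \<phi> u') | u u'.
     u \<in> infinite_traces (Oe \<union> Op) \<and> u' \<in> infinite_traces (Oe \<union> Op) \<and>
     (\<exists>\<pi>p \<in> finite_traces Op (length w).
        (map fst w \<squnion>\<^sub>t \<pi>p) \<frown> u \<Turnstile> \<phi> \<and> (map snd w \<squnion>\<^sub>t \<pi>p) \<frown> u' \<Turnstile> \<phi>)}"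

lemma joint_types_empty_iff:
  "joint_types Oe Op \<phi> w = {} \<longleftrightarrow> (\<forall>\<pi>p \<in> finite_traces Op (length w).
     \<not> fin_sat (Oe \<union> Op) (map fst w \<squnion>\<^sub>t \<pi>p) \<phi> \<or> \<not> fin_sat (Oe \<union> Op) (map snd w \<squnion>\<^sub>t \<pi>p) \<phi>)"
  unfolding joint_types_def fin_sat_iff by blast

lemma joint_types_subset:
  "joint_types Oe Op \<phi> w \<subseteq> Pow (subformulas \<phi>) \<times> Pow (subformulas \<phi>)"
  unfolding joint_types_def ltl_type_def by auto

text \<open>Membership does not depend on the words representing the two types: the witnesses from
  the definition can be exchanged for \<open>u\<close> and \<open>u'\<close> by
  \<open>sat_conc_type_cong\<close>.\<close>

lemma in_joint_types_iff:
  assumes "u \<in> infinite_traces (Oe \<union> Op)" "u' \<in> infinite_traces (Oe \<union> Op)"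
  shows "(ltl_type \<phi> u, ltl_type \<phi> u') \<in> joint_types Oe Op \<phi> w \<longleftrightarrow>
    (\<exists>\<pi>p \<in> finite_traces Op (length w).
       (map fst w \<squnion>\<^sub>t \<pi>p) \<frown> u \<Turnstile> \<phi> \<and> (map snd w \<squnion>\<^sub>t \<pi>p) \<frown> u' \<Turnstile> \<phi>)"
proof
  assume "(ltl_type \<phi> u, ltl_type \<phi> u') \<in> joint_types Oe Op \<phi> w"
  then obtain v v' where v: "ltl_type \<phi> u = ltl_type \<phi> v" "ltl_type \<phi> u' = ltl_type \<phi> v'"
    and "\<exists>\<pi>p \<in> finite_traces Op (length w).
       (map fst w \<squnion>\<^sub>t \<pi>p) \<frown> v \<Turnstile> \<phi> \<and> (map snd w \<squnion>\<^sub>t \<pi>p) \<frown> v' \<Turnstile> \<phi>"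
    unfolding joint_types_def by blast
  then show "\<exists>\<pi>p \<in> finite_traces Op (length w).
       (map fst w \<squnion>\<^sub>t \<pi>p) \<frown> u \<Turnstile> \<phi> \<and> (map snd w \<squnion>\<^sub>t \<pi>p) \<frown> u' \<Turnstile> \<phi>"
    by (simp add: sat_conc_type_cong[OF v(1)] sat_conc_type_cong[OF v(2)])
qed (use assms in \<open>unfold joint_types_def, blast\<close>)

lemma bex_finite_traces_Suc:
  "(\<exists>\<sigma> \<in> finite_traces V (Suc n). P \<sigma>) \<longleftrightarrow> (\<exists>y \<subseteq> V. \<exists>\<tau> \<in> finite_traces V n. P (\<tau> @ [y]))"
proof
  assume "\<exists>\<sigma> \<in> finite_traces V (Suc n). P \<sigma>"
  then obtain \<sigma> where "\<sigma> \<in> finite_traces V (Suc n)" "P \<sigma>" by blast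
  then show "\<exists>y \<subseteq> V. \<exists>\<tau> \<in> finite_traces V n. P (\<tau> @ [y])"
    unfolding finite_traces_def by (cases \<sigma> rule: rev_cases) auto
next
  assume "\<exists>y \<subseteq> V. \<exists>\<tau> \<in> finite_traces V n. P (\<tau> @ [y])"
  then obtain y \<tau> where "y \<subseteq> V" "\<tau> \<in> finite_traces V n" "P (\<tau> @ [y])" by blast
  moreover from this have "\<tau> @ [y] \<in> finite_traces V (Suc n)" by (simp add: finite_traces_def)
  ultimately show "\<exists>\<sigma> \<in> finite_traces V (Suc n). P \<sigma>" by blast
qed

lemma trace_join_snoc:
  assumes "length \<sigma> = length \<tau>"
  shows "(\<sigma> @ [x]) \<squnion>\<^sub>t (\<tau> @ [y]) = (\<sigma> \<squnion>\<^sub>t \<tau>) @ [x \<union> y]"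
  using assms unfolding trace_join_def by simp

text \<open>The last letter moves from the end of the finite trace to the front of the continuation.
  The same \<open>y\<close> extends both sides, as it is the last letter of the shared
  trace.\<close>

lemma in_joint_types_snoc_iff:
  assumes "x \<subseteq> Oe" "x' \<subseteq> Oe"
    and u: "u \<in> infinite_traces (Oe \<union> Op)" "u' \<in> infinite_traces (Oe \<union> Op)"
  shows "(ltl_type \<phi> u, ltl_type \<phi> u') \<in> joint_types Oe Op \<phi> (w @ [(x, x')]) \<longleftrightarrow>
    (\<exists>y \<subseteq> Op. (ltl_type \<phi> ((x \<union> y) ## u), ltl_type \<phi> ((x' \<union> y) ## u')) \<in> joint_types Oe Op \<phi> w)"
    (is "?L \<longleftrightarrow> (\<exists>y \<subseteq> Op. ?R y)")
proof -
  have conc: "((map g w @ [z]) \<squnion>\<^sub>t (\<pi>p @ [y])) \<frown> v = (map g w \<squnion>\<^sub>t \<pi>p) \<frown> ((z \<union> y) ## v)"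
    if "\<pi>p \<in> finite_traces Op (length w)" for g z \<pi>p y and v :: "'a set word"
  proof -
    have len: "length (map g w) = length \<pi>p"
      using that by (simp add: finite_traces_def)
    show ?thesis
      by (simp add: trace_join_snoc[OF len])
  qed
  have R: "?R y \<longleftrightarrow> (\<exists>\<pi>p \<in> finite_traces Op (length w).
      (map fst w \<squnion>\<^sub>t \<pi>p) \<frown> ((x \<union> y) ## u) \<Turnstile> \<phi> \<and> (map snd w \<squnion>\<^sub>t \<pi>p) \<frown> ((x' \<union> y) ## u') \<Turnstile> \<phi>)"
    if "y \<subseteq> Op" for y
    using assms that by (intro in_joint_types_iff) (auto simp: build_infinite_traces)
  have L: "?L \<longleftrightarrow> (\<exists>y \<subseteq> Op. \<exists>\<pi>p \<in> finite_traces Op (length w).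
      (map fst w \<squnion>\<^sub>t \<pi>p) \<frown> ((x \<union> y) ## u) \<Turnstile> \<phi> \<and> (map snd w \<squnion>\<^sub>t \<pi>p) \<frown> ((x' \<union> y) ## u') \<Turnstile> \<phi>)"
    unfolding in_joint_types_iff[OF u]
    by (simp add: bex_finite_traces_Suc conc del: build_append cong: bex_cong)
  show ?thesis unfolding L by (simp add: R cong: conj_cong)
qed

text \<open>By \<open>in_joint_types_snoc_iff\<close>, the set after one more letter is determined
  by the set before it; this is the right congruence that the automaton requires.\<close>

lemma joint_types_snoc_cong:
  assumes "x \<subseteq> Oe" "x' \<subseteq> Oe" "joint_types Oe Op \<phi> w = joint_types Oe Op \<phi> w'"
  shows "joint_types Oe Op \<phi> (w @ [(x, x')]) = joint_types Oe Op \<phi> (w' @ [(x, x')])"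
proof -
  have "joint_types Oe Op \<phi> (v @ [(x, x')]) \<subseteq> joint_types Oe Op \<phi> (v' @ [(x, x')])"
    if "joint_types Oe Op \<phi> v = joint_types Oe Op \<phi> v'" for v v'
  proof
    fix p assume p: "p \<in> joint_types Oe Op \<phi> (v @ [(x, x')])"
    then obtain u u' where u: "u \<in> infinite_traces (Oe \<union> Op)" "u' \<in> infinite_traces (Oe \<union> Op)"
      and "p = (ltl_type \<phi> u, ltl_type \<phi> u')"
      unfolding joint_types_def by blast
    then show "p \<in> joint_types Oe Op \<phi> (v' @ [(x, x')])"
      using p that in_joint_types_snoc_iff[OF assms(1,2) u] by simp
  qed
  then show ?thesis using assms(3) by (metis subset_antisym)
qed

section \<open>The relation in terms of joint types, and the number of states\<close>

lemma prefix_dist_iff_joint_types: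
  assumes "w \<in> lists (Pow Oe \<times> Pow Oe)"
  shows "(map fst w, map snd w) \<in> prefix_dist Oe Op \<phi> \<longleftrightarrow>
    joint_types Oe Op \<phi> w = {} \<and> (\<forall>n < length w. joint_types Oe Op \<phi> (take n w) \<noteq> {})"
proof -
  \<comment> \<open>This forces the existentially quantified \<open>m\<close> of
    \<open>prefix_dist\<close> to be \<open>length w\<close>.\<close>
  have m: "map fst w \<in> finite_traces Oe m \<and> map snd w \<in> finite_traces Oe m \<longleftrightarrow> m = length w" for m
  proof -
    have "fst ` set w \<subseteq> Pow Oe" "snd ` set w \<subseteq> Pow Oe"
      using assms by (auto simp: in_lists_conv_set mem_Times_iff)
    then show ?thesis unfolding finite_traces_def by auto
  qed
  have "(map fst w, map snd w) \<in> prefix_dist Oe Op \<phi> \<longleftrightarrow>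
     (\<forall>\<pi>p \<in> finite_traces Op (length w). \<not> fin_sat (Oe \<union> Op) (map fst w \<squnion>\<^sub>t \<pi>p) \<phi> \<or>
        \<not> fin_sat (Oe \<union> Op) (map snd w \<squnion>\<^sub>t \<pi>p) \<phi>) \<and>
     (\<forall>n < length w. \<exists>\<pi>p \<in> finite_traces Op n.
        fin_sat (Oe \<union> Op) (take n (map fst w) \<squnion>\<^sub>t \<pi>p) \<phi> \<and>
        fin_sat (Oe \<union> Op) (take n (map snd w) \<squnion>\<^sub>t \<pi>p) \<phi>)"
    unfolding prefix_dist_def mem_Collect_eq case_prod_conv conj_assoc[symmetric] m by simp
  then show ?thesis
    unfolding joint_types_empty_iff take_map by (simp add: min_absorb2)
qed

lemma
  shows finite_joint_types: "finite (joint_types Oe Op \<phi> ` W)"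
    and card_joint_types_le: "card (joint_types Oe Op \<phi> ` W) \<le> 2 ^ (2 ^ (2 * ltl_length \<phi>))"
proof -
  let ?Q = "Pow (Pow (subformulas \<phi>) \<times> Pow (subformulas \<phi>))"
  have sub: "joint_types Oe Op \<phi> ` W \<subseteq> ?Q"
    using joint_types_subset[of Oe Op \<phi>] by blast
  have fin: "finite ?Q" by (simp add: finite_subformulas)
  have "card ?Q = 2 ^ (2 ^ (2 * card (subformulas \<phi>)))"
    by (simp add: card_Pow card_cartesian_product finite_subformulas mult_2 power_add)
  also have "\<dots> \<le> 2 ^ (2 ^ (2 * ltl_length \<phi>))"
    using card_subformulas_le[of \<phi>] by simp
  finally show "card (joint_types Oe Op \<phi> ` W) \<le> 2 ^ (2 ^ (2 * ltl_length \<phi>))"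
    using card_mono[OF fin sub] by linarith
  show "finite (joint_types Oe Op \<phi> ` W)"
    using finite_subset[OF sub fin] .
qed

theorem theorem1:
  shows "\<exists>c::nat. \<forall>(Oe::'a set) (Op::'a set) (\<phi>::'a ltl).
    finite Oe \<and> finite Op \<and> Oe \<inter> Op = {} \<and> atoms \<phi> \<subseteq> Op \<union> Oe \<longrightarrow>
    (\<exists>A :: (nat, 'a set \<times> 'a set) nfa.
       nfa_over (Pow Oe \<times> Pow Oe) A \<and>
       card (states A) \<le> 2 ^ (2 ^ (c * ltl_length \<phi>)) \<and>
       (\<forall>w \<in> lists (Pow Oe \<times> Pow Oe).
          nfa_accepts A w \<longleftrightarrow> (map fst w, map snd w) \<in> prefix_dist Oe Op \<phi>))"
\<comment> \<open>The constant is 2 because a state is a set of pairs of types, and \<open>n\<close>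
  subformulas allow at most \<open>2 ^ (2 * n)\<close> such pairs.\<close>
proof (intro exI[of _ 2] allI impI, elim conjE)
  fix Oe Op :: "'a set" and \<phi> :: "'a ltl"
  assume "finite Oe"
  let ?\<Sigma> = "Pow Oe \<times> Pow Oe"
  let ?S = "joint_types Oe Op \<phi>"
  have cong: "?S (v @ [p]) = ?S (v' @ [p])" if "p \<in> ?\<Sigma>" "?S v = ?S v'" for v v' p
    using that joint_types_snoc_cong[of "fst p" Oe "snd p" Op \<phi> v v'] by (simp add: mem_Times_iff)
  \<comment> \<open>Here \<open>F\<close> is \<open>{{}}\<close>, whose only element is the empty
    set of pairs, and \<open>E\<close> is its complement.\<close>
  have "\<exists>A :: (nat, 'a set \<times> 'a set) nfa. nfa_over ?\<Sigma> A \<and>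
    card (states A) = card (?S ` lists ?\<Sigma>) \<and>
    (\<forall>w \<in> lists ?\<Sigma>. nfa_accepts A w \<longleftrightarrow> ?S w \<in> {{}} \<and> (\<forall>n < length w. ?S (take n w) \<in> - {{}}))"
  proof (rule nfa_of_right_congruence)
    show "finite ?\<Sigma>" using \<open>finite Oe\<close> by simp
  qed (simp add: finite_joint_types, rule cong)
  then obtain A :: "(nat, 'a set \<times> 'a set) nfa" where "nfa_over ?\<Sigma> A"
    and "card (states A) = card (?S ` lists ?\<Sigma>)"
    and "\<forall>w \<in> lists ?\<Sigma>. nfa_accepts A w \<longleftrightarrow> ?S w = {} \<and> (\<forall>n < length w. ?S (take n w) \<noteq> {})"
    unfolding singleton_iff Compl_iff by blast
  then show "\<exists>A :: (nat, 'a set \<times> 'a set) nfa. nfa_over ?\<Sigma> A \<and>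
    card (states A) \<le> 2 ^ (2 ^ (2 * ltl_length \<phi>)) \<and>
    (\<forall>w \<in> lists ?\<Sigma>. nfa_accepts A w \<longleftrightarrow> (map fst w, map snd w) \<in> prefix_dist Oe Op \<phi>)"
    using card_joint_types_le[of Oe Op \<phi> "lists ?\<Sigma>"] prefix_dist_iff_joint_types[of _ Oe Op \<phi>]
    by metis
qed

end
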